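(* Let $M$ be a matroid with a basis $B_0$, let $R=E\setminus B_0$ have size $g$, and let $\mathcal C=(C_i)_{i\in R}$ be the fundamental circuits, so that a nonempty set $S\subseteq R$ can be fired from $c\in\mathbb N^R$ when $c_i\ge|C_i\cap U_S|$ for every $i\in S$. Then the set $\mathcal P^*(\mathcal C)$ of coparking functions is a nonempty multicomplex, and every maximal coparking function has degree $$|A_R|-g=r(A_R),$$ which is $r(M)$ minus the number of coloops of $M$. Moreover, for $c\in\mathbb N^R$, one has $c\in\mathcal P^*(\mathcal C)$ if and only if there is an ordering $s_1,\dots,s_g$ of $R$ such that $$c_{s_m}<\bigl|C_{s_m}\setminus A_{\{s_{m+1},\dots,s_g\}}\bigr|\qquad\text{for all }1\le m\le g.$$
   Context: $M$ is a matroid on a finite ground set $E$ with rank function $r$. For $i\in R=E\setminus B_0$, $C_i$ is the fundamental circuit of $i$, the unique circuit contained in $B_0\cup\{i\}$. For $S\subseteq R$, $A_S=\bigcup_{i\in S}C_i$ (so $A_\emptyset=\emptyset$) and $U_S$ is the set of elements of $E$ lying in exactly one $C_i$ with $i\in S$. The set $\mathcal P^*(\mathcal C)$ of coparking functions consists of the vectors $c\in\mathbb N^R$ from which no nonempty $S\subseteq R$ can be fired, i.e. for every nonempty $S\subseteq R$ there is $i\in S$ with $c_i<|C_i\cap U_S|$. A multicomplex is a finite set of monomials, identified with exponent vectors in $\mathbb N^R$, closed under division (i.e. under passing to coordinatewise smaller vectors). The degree of $c$ is $\sum_i c_i$, and maximal means maximal in the coordinatewise order among the elements of the set. *)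

theory Defs
  imports Main "HOL-Library.FuncSet"
begin

section \<open>Finite matroids, given by their independent sets\<close>

locale matroid =
  fixes E :: "'a set" and indep :: "'a set \<Rightarrow> bool"
  assumes finite_ground: "finite E"
    and indep_subset: "indep X \<Longrightarrow> X \<subseteq> E"
    and indep_empty: "indep {}"
    and indep_mono: "indep X \<Longrightarrow> Y \<subseteq> X \<Longrightarrow> indep Y"
    and indep_augment:
      "indep X \<Longrightarrow> indep Y \<Longrightarrow> card X < card Y \<Longrightarrow> \<exists>x\<in>Y - X. indep (insert x X)"

text \<open>
  The following notions are plain constants rather than locale definitions; a matroid enters
  through its ground set and independence predicate.
\<close>

definition mrank :: "('a set \<Rightarrow> bool) \<Rightarrow> 'a set \<Rightarrow> nat" where
  "mrank indep X = Max {card I |I. I \<subseteq> X \<and> indep I}"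

definition basis :: "('a set \<Rightarrow> bool) \<Rightarrow> 'a set \<Rightarrow> bool" where
  "basis indep B \<longleftrightarrow> indep B \<and> (\<forall>I. indep I \<and> B \<subseteq> I \<longrightarrow> I = B)"

definition circuit :: "'a set \<Rightarrow> ('a set \<Rightarrow> bool) \<Rightarrow> 'a set \<Rightarrow> bool" where
  "circuit E indep C \<longleftrightarrow> C \<subseteq> E \<and> \<not> indep C \<and> (\<forall>D. D \<subset> C \<longrightarrow> indep D)"

definition coloop :: "'a set \<Rightarrow> ('a set \<Rightarrow> bool) \<Rightarrow> 'a \<Rightarrow> bool" where
  "coloop E indep e \<longleftrightarrow> e \<in> E \<and> (\<forall>B. basis indep B \<longrightarrow> e \<in> B)"

definition fund_circuit :: "'a set \<Rightarrow> ('a set \<Rightarrow> bool) \<Rightarrow> 'a set \<Rightarrow> 'a \<Rightarrow> 'a set" where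
  "fund_circuit E indep B i = (THE C. circuit E indep C \<and> C \<subseteq> B \<union> {i})"

text \<open>The definite description above denotes whenever \<open>B\<close> is a basis and \<open>i \<in> E - B\<close>.\<close>

lemma (in matroid) ex1_fund_circuit:
  assumes B: "basis indep B" and i: "i \<in> E - B"
  shows "\<exists>!C. circuit E indep C \<and> C \<subseteq> B \<union> {i}"
proof -
  let ?X = "insert i B"
  have indB: "indep B" using B by (simp add: basis_def)
  have XE: "?X \<subseteq> E" using indep_subset[OF indB] i by auto
  have finX: "finite ?X" by (rule finite_subset[OF XE finite_ground])
  have depX: "\<not> indep ?X" using B i unfolding basis_def by blast
  let ?D = "{D. D \<subseteq> ?X \<and> \<not> indep D}"
  have D: "finite ?D" "?D \<noteq> {}" using finX depX by auto
  obtain C where C: "C \<in> ?D" "\<forall>D\<in>?D. D \<subseteq> C \<longrightarrow> C = D"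
    using finite_has_minimal[OF D] by (elim bexE)
  have minC: "indep D" if "D \<subset> C" for D
  proof (rule ccontr)
    assume "\<not> indep D"
    then have "D \<in> ?D" using C(1) that by auto
    then show False using C(2) that by blast
  qed
  have exC: "circuit E indep C \<and> C \<subseteq> B \<union> {i}"
    unfolding circuit_def using C(1) XE minC by auto
  have sub: "C1 \<subseteq> C2"
    if c1: "circuit E indep C1" "C1 \<subseteq> ?X" and c2: "circuit E indep C2" "C2 \<subseteq> ?X" for C1 C2
  proof (rule ccontr)
    assume "\<not> C1 \<subseteq> C2"
    then obtain e where e: "e \<in> C1" "e \<notin> C2" by auto
    let ?J = "{J. C1 - {e} \<subseteq> J \<and> J \<subseteq> ?X \<and> indep J}"
    have "indep (C1 - {e})" using c1 e unfolding circuit_def by blast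
    then have "C1 - {e} \<in> ?J" using c1(2) by auto
    then have neJ: "?J \<noteq> {}" by (metis empty_iff)
    have finJ: "finite ?J" using finX by auto
    obtain J where J: "J \<in> ?J" "\<forall>K\<in>?J. J \<subseteq> K \<longrightarrow> J = K"
      using finite_has_maximal[OF finJ neJ] by (elim bexE)
    have "\<not> card J < card B"
    proof
      assume "card J < card B"
      then obtain x where x: "x \<in> B - J" "indep (insert x J)"
        using indep_augment[of J B] J(1) indB by auto
      then have "insert x J \<in> ?J" using J(1) by auto
      then show False using bspec[OF J(2), of "insert x J"] x(1) by blast
    qed
    moreover have eJ: "e \<notin> J"
    proof
      assume "e \<in> J"
      then have "C1 \<subseteq> J" using J(1) by auto
      then have "indep C1" using J(1) by (auto intro: indep_mono)
      then show False using c1(1) by (simp add: circuit_def)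
    qed
    moreover have eX: "e \<in> ?X" using e c1 by auto
    moreover have "card (?X - {e}) = card B" using eX finX i by auto
    moreover have JX: "J \<subseteq> ?X - {e}" using J(1) eJ by auto
    ultimately have "J = ?X - {e}" using card_seteq[OF _ JX] finX by simp
    then have "C2 \<subseteq> J" using c2 e by auto
    then have "indep C2" using J(1) by (auto intro: indep_mono)
    then show False using c2(1) by (simp add: circuit_def)
  qed
  show ?thesis
  proof (rule ex1I[of _ C])
    show "circuit E indep C \<and> C \<subseteq> B \<union> {i}" by (rule exC)
    show "C' = C" if "circuit E indep C' \<and> C' \<subseteq> B \<union> {i}" for C'
      using sub[of C' C] sub[of C C'] exC that by simp
  qed
qed

section \<open>Coparking functions\<close>

text \<open>
  \<open>C\<close> is a family of sets; only its values on the index set \<open>R\<close> matter.  For the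
  fundamental circuits \<open>cover C S\<close> is \<open>A\<^sub>S\<close> and \<open>once_covered C S\<close> is \<open>U\<^sub>S\<close>; the latter needs no
  restriction to the ground set, since all its members lie in some \<open>C i\<close>.
\<close>

definition cover :: "('a \<Rightarrow> 'b set) \<Rightarrow> 'a set \<Rightarrow> 'b set" where
  "cover C S = (\<Union>i\<in>S. C i)"

definition once_covered :: "('a \<Rightarrow> 'b set) \<Rightarrow> 'a set \<Rightarrow> 'b set" where
  "once_covered C S = {e. \<exists>!i. i \<in> S \<and> e \<in> C i}"

definition can_fire :: "('a \<Rightarrow> 'b set) \<Rightarrow> ('a \<Rightarrow> nat) \<Rightarrow> 'a set \<Rightarrow> bool" where
  "can_fire C c S \<longleftrightarrow> (\<forall>i\<in>S. c i \<ge> card (C i \<inter> once_covered C S))"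

text \<open>
  Vectors in \<open>\<nat>\<^sup>R\<close> are the extensional functions on \<open>R\<close>, so that equality of functions
  is equality of vectors.
\<close>

abbreviation nat_vectors :: "'a set \<Rightarrow> ('a \<Rightarrow> nat) set" where
  "nat_vectors R \<equiv> R \<rightarrow>\<^sub>E UNIV"

definition coparking :: "'a set \<Rightarrow> ('a \<Rightarrow> 'b set) \<Rightarrow> ('a \<Rightarrow> nat) set" where
  "coparking R C = {c \<in> nat_vectors R. \<forall>S. S \<subseteq> R \<and> S \<noteq> {} \<longrightarrow> \<not> can_fire C c S}"

definition multicomplex :: "'a set \<Rightarrow> ('a \<Rightarrow> nat) set \<Rightarrow> bool" where
  "multicomplex R P \<longleftrightarrow> P \<subseteq> nat_vectors R \<and> finite P \<and>
     (\<forall>c\<in>P. \<forall>d\<in>nat_vectors R. (\<forall>i\<in>R. d i \<le> c i) \<longrightarrow> d \<in> P)"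

definition maximal_in :: "'a set \<Rightarrow> ('a \<Rightarrow> nat) set \<Rightarrow> ('a \<Rightarrow> nat) \<Rightarrow> bool" where
  "maximal_in R P c \<longleftrightarrow> c \<in> P \<and> (\<forall>d\<in>P. (\<forall>i\<in>R. c i \<le> d i) \<longrightarrow> d = c)"

definition vdegree :: "'a set \<Rightarrow> ('a \<Rightarrow> nat) \<Rightarrow> nat" where
  "vdegree R c = (\<Sum>i\<in>R. c i)"

end

theory Submission
  imports Defs
begin

text \<open>
  For \<open>i \<in> S\<close>, the part of \<open>C i\<close> covered only once by \<open>S\<close> is \<open>C i - cover C (S - {i})\<close>
  (\<open>Int_once_covered\<close>), so it grows when the other members of \<open>S\<close> become fewer.  This monotonicity
  drives the combinatorial half, which concerns arbitrary finite families of sets.  If no nonempty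
  subset of \<open>R\<close> can be fired, then some \<open>s 1 \<in> R\<close> violates the firing condition for \<open>R\<close>; the same
  hypothesis holds for \<open>R - {s 1}\<close>, and repetition yields the required ordering.
  Conversely, given an ordering, the earliest member of any nonempty \<open>S\<close> sees in the rest of \<open>S\<close>
  only later elements, so it blocks the firing of \<open>S\<close> (\<open>coparking_iff_ordering\<close>).

  For a fixed ordering \<open>s\<close> the vectors that it certifies, if there are any, are exactly those
  bounded by \<open>i = s m \<mapsto> card (C i - cover C {later elements}) - 1\<close>.  Hence a maximal
  coparking function is such a bound.  Each point of \<open>cover C R\<close> is counted once, at the last index whose set contains
  it, so the degree telescopes to \<open>card (cover C R) - card R\<close>, whatever the ordering
  (\<open>vdegree_maximal_coparking\<close>).  Fundamental circuits enter here only as finite sets and through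
  the fact that \<open>i\<close> lies in \<open>C i\<close> and in no other \<open>C j\<close>: the counts are therefore positive, and the zero vector is coparking.

  On the matroid side, \<open>cover C R\<close> is the disjoint union of \<open>R\<close> and a part of \<open>B0\<close>.  That part
  is independent, and it spans \<open>cover C R\<close> because the circuit of every \<open>i \<in> R\<close> lies in it except
  for \<open>i\<close> itself.  The elements of \<open>B0\<close> that remain outside are precisely the coloops, because
  \<open>e \<in> B0\<close> can be exchanged for \<open>i\<close> exactly when \<open>e \<in> C i\<close> (\<open>coloops_eq\<close>).
\<close>

section \<open>Firing and orderings for families of finite sets\<close>

lemma Int_once_covered:
  assumes "i \<in> S"
  shows "C i \<inter> once_covered C S = C i - cover C (S - {i})"
  using assms unfolding once_covered_def cover_def by blast

abbreviation fresh :: "('a \<Rightarrow> 'b set) \<Rightarrow> (nat \<Rightarrow> 'a) \<Rightarrow> nat \<Rightarrow> nat \<Rightarrow> 'b set" where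
  "fresh C s g m \<equiv> C (s m) - cover C (s ` {m+1..g})"

text \<open>
  Peeling: the induction removes an element that blocks the firing of the whole set and
  puts it in front of an ordering of the rest.
\<close>

lemma ordering_if_unfirable:
  assumes "finite R" and "\<And>S. S \<subseteq> R \<Longrightarrow> S \<noteq> {} \<Longrightarrow> \<not> can_fire C c S"
  shows "\<exists>s. bij_betw s {1..card R} R \<and> (\<forall>m\<in>{1..card R}. c (s m) < card (fresh C s (card R) m))"
  using assms
proof (induction "card R" arbitrary: R)
  case 0
  then show ?case by (simp add: bij_betw_def)
next
  case (Suc n)
  have "R \<noteq> {}" using Suc.hyps(2) by auto
  then have "\<not> can_fire C c R" using Suc.prems(2) by blast
  then obtain x where x: "x \<in> R" "c x < card (C x \<inter> once_covered C R)"
    unfolding can_fire_def by (meson not_le)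
  let ?R' = "R - {x}"
  have n: "n = card ?R'" using Suc.hyps(2) x(1) Suc.prems(1) by simp
  have "\<exists>s. bij_betw s {1..card ?R'} ?R' \<and>
      (\<forall>m\<in>{1..card ?R'}. c (s m) < card (fresh C s (card ?R') m))"
    using Suc.hyps(1)[OF n] Suc.prems by blast
  then obtain s where s: "bij_betw s {1..n} ?R'"
      "\<And>m. m \<in> {1..n} \<Longrightarrow> c (s m) < card (fresh C s n m)"
    unfolding n[symmetric] by blast
  define s' where "s' m = (if m = 1 then x else s (m - 1))" for m
  have img: "s' ` {m+1..Suc n} = s ` {m..n}" if "m \<ge> 1" for m
  proof -
    have "s' ` {m+1..Suc n} = s' ` (Suc ` {m..n})" by (simp add: image_Suc_atLeastAtMost)
    also have "\<dots> = (\<lambda>k. s' (Suc k)) ` {m..n}" by (rule image_image)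
    also have "\<dots> = s ` {m..n}" using that by (intro image_cong) (auto simp: s'_def)
    finally show ?thesis .
  qed
  have im1: "s' ` {2..Suc n} = ?R'"
    using img[of 1] s(1) by (simp add: bij_betw_def numeral_2_eq_2)
  have "{1..Suc n} = insert 1 {2..Suc n}" by auto
  then have "s' ` {1..Suc n} = insert (s' 1) (s' ` {2..Suc n})" by (simp only: image_insert)
  also have "\<dots> = R" unfolding im1 using x(1) by (auto simp: s'_def)
  finally have surj: "s' ` {1..Suc n} = R" .
  then have "inj_on s' {1..Suc n}"
    using Suc.hyps(2) by (intro eq_card_imp_inj_on) auto
  then have bij: "bij_betw s' {1..Suc n} R" using surj by (simp add: bij_betw_def)
  have "c (s' m) < card (fresh C s' (Suc n) m)" if m: "m \<in> {1..Suc n}" for m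
  proof (cases "m = 1")
    case True
    then show ?thesis
      using x im1 Int_once_covered[OF x(1), of C] by (simp add: s'_def numeral_2_eq_2)
  next
    case False
    then have m': "m - 1 \<in> {1..n}" "m - 1 + 1 = m" using m by auto
    show ?thesis using s(2)[OF m'(1)] False m' img[of m] m by (simp add: s'_def)
  qed
  then show ?case using bij unfolding Suc.hyps(2)[symmetric] by blast
qed

text \<open>
  The earliest member of \<open>S\<close> in the ordering blocks the firing of \<open>S\<close>.
\<close>

lemma unfirable_if_ordering:
  assumes fin: "\<And>i. i \<in> R \<Longrightarrow> finite (C i)"
    and bij: "bij_betw s {1..g} R"
    and c: "\<And>m. m \<in> {1..g} \<Longrightarrow> c (s m) < card (fresh C s g m)"
    and S: "S \<subseteq> R" "S \<noteq> {}"
  shows "\<not> can_fire C c S"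
proof
  assume fire: "can_fire C c S"
  have R: "R = s ` {1..g}" using bij by (simp add: bij_betw_def)
  define K where "K = {k \<in> {1..g}. s k \<in> S}"
  have K: "finite K" "K \<noteq> {}" using S R unfolding K_def by auto
  define m where "m = Min K"
  have "m \<in> K" using K unfolding m_def by (rule Min_in)
  then have m: "m \<in> {1..g}" "s m \<in> S" unfolding K_def by auto
  have "S - {s m} \<subseteq> s ` {m+1..g}"
  proof
    fix y assume y: "y \<in> S - {s m}"
    then obtain k where k: "k \<in> {1..g}" "y = s k" using S(1) R by auto
    then have "k \<in> K" using y unfolding K_def by auto
    then have "m \<le> k" using K(1) unfolding m_def by (rule Min_le[rotated])
    moreover have "m \<noteq> k" using k y by auto
    ultimately show "y \<in> s ` {m+1..g}" using k by auto
  qed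
  then have "fresh C s g m \<subseteq> C (s m) - cover C (S - {s m})"
    unfolding cover_def by blast
  then have "card (fresh C s g m) \<le> card (C (s m) - cover C (S - {s m}))"
    using fin m(2) S(1) by (intro card_mono) auto
  also have "\<dots> \<le> c (s m)"
    using fire m(2) Int_once_covered[OF m(2), of C] unfolding can_fire_def by auto
  finally show False using c[OF m(1)] by simp
qed

lemma coparking_iff_ordering:
  assumes "finite R" and "\<And>i. i \<in> R \<Longrightarrow> finite (C i)" and "c \<in> nat_vectors R"
  shows "c \<in> coparking R C \<longleftrightarrow>
    (\<exists>s. bij_betw s {1..card R} R \<and> (\<forall>m\<in>{1..card R}. c (s m) < card (fresh C s (card R) m)))"
    (is "_ \<longleftrightarrow> ?ord")
proof
  assume "c \<in> coparking R C"
  then show ?ord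
    unfolding coparking_def by (intro ordering_if_unfirable assms(1)) blast
next
  assume ?ord
  then obtain s where "bij_betw s {1..card R} R"
      "\<forall>m\<in>{1..card R}. c (s m) < card (fresh C s (card R) m)" by blast
  then have "\<not> can_fire C c S" if "S \<subseteq> R" "S \<noteq> {}" for S
    using unfirable_if_ordering[where R = R and C = C] assms(2) that by blast
  then show "c \<in> coparking R C" using assms(3) unfolding coparking_def by blast
qed

text \<open>
  Firing gets easier when the vector grows, and the singletons \<open>{i}\<close> already force
  \<open>c i < card (C i)\<close>, which gives finiteness.
\<close>

lemma multicomplex_coparking:
  assumes "finite R"
  shows "multicomplex R (coparking R C)"
proof -
  have "c i < card (C i)" if c: "c \<in> coparking R C" and i: "i \<in> R" for c i
  proof -
    have "\<not> can_fire C c {i}" using c i unfolding coparking_def by blast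
    then show ?thesis
      using Int_once_covered[of i "{i}" C] by (simp add: can_fire_def cover_def)
  qed
  then have "coparking R C \<subseteq> (\<Pi>\<^sub>E i\<in>R. {..<card (C i)})"
    unfolding coparking_def PiE_def by auto
  then have "finite (coparking R C)"
    by (rule finite_subset) (simp add: assms finite_PiE)
  moreover have "d \<in> coparking R C"
    if c: "c \<in> coparking R C" and d: "d \<in> nat_vectors R" and le: "\<forall>i\<in>R. d i \<le> c i" for c d
  proof -
    have "can_fire C c S" if "can_fire C d S" "S \<subseteq> R" for S
      using that le unfolding can_fire_def by (meson order_trans subsetD)
    then show ?thesis using c d unfolding coparking_def by blast
  qed
  ultimately show ?thesis unfolding multicomplex_def by (auto simp: coparking_def)
qed

text \<open>
  The fresh parts partition the cover: a point belongs to the fresh part of the last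
  member that contains it.
\<close>

lemma sum_card_fresh:
  assumes "\<And>m. m \<in> {1..g} \<Longrightarrow> finite (C (s m))"
  shows "(\<Sum>m\<in>{1..g}. card (fresh C s g m)) = card (cover C (s ` {1..g}))"
proof -
  have "(\<Sum>m\<in>{k+1..g}. card (fresh C s g m)) = card (cover C (s ` {k+1..g}))" if "k \<le> g" for k
    using that
  proof (induction k rule: inc_induct)
    case base
    then show ?case by (simp add: cover_def)
  next
    case (step k)
    have k: "{k+1..g} = insert (k+1) {Suc k+1..g}" using step.hyps by auto
    let ?A = "cover C (s ` {Suc k+1..g})"
    have "finite ?A" using assms by (auto simp: cover_def)
    moreover have "finite (C (s (k+1)))" using assms step.hyps by simp
    ultimately have "card (fresh C s g (k+1) \<union> ?A) = card (fresh C s g (k+1)) + card ?A"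
      by (intro card_Un_disjoint) auto
    moreover have "fresh C s g (k+1) \<union> ?A = cover C (s ` {k+1..g})"
      unfolding k cover_def by auto
    ultimately show ?case using step.IH unfolding k by simp
  qed
  from this[of 0] show ?thesis by simp
qed

text \<open>
  An ordering that certifies \<open>c\<close> also certifies the largest vector below the sizes of its
  fresh parts, so a maximal \<open>c\<close> equals this vector and its degree is a sum of fresh parts.
\<close>

lemma vdegree_maximal_coparking:
  assumes finR: "finite R" and fin: "\<And>i. i \<in> R \<Longrightarrow> finite (C i)"
    and max: "maximal_in R (coparking R C) c"
  shows "vdegree R c + card R = card (cover C R)"
proof -
  let ?g = "card R"
  have c: "c \<in> coparking R C" "c \<in> nat_vectors R"
    using max unfolding maximal_in_def coparking_def by auto
  have iff: "v \<in> coparking R C \<longleftrightarrow>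
      (\<exists>s. bij_betw s {1..?g} R \<and> (\<forall>m\<in>{1..?g}. v (s m) < card (fresh C s ?g m)))"
    if "v \<in> nat_vectors R" for v
    using finR fin that by (rule coparking_iff_ordering)
  obtain s where bij: "bij_betw s {1..?g} R"
      and s: "\<And>m. m \<in> {1..?g} \<Longrightarrow> c (s m) < card (fresh C s ?g m)"
    using c(1) unfolding iff[OF c(2)] by auto
  have R: "s ` {1..?g} = R" and inj: "inj_on s {1..?g}" using bij by (auto simp: bij_betw_def)
  define d where
    "d = restrict (\<lambda>i. card (fresh C s ?g (inv_into {1..?g} s i)) - 1) R"
  have d: "d (s m) = card (fresh C s ?g m) - 1" if "m \<in> {1..?g}" for m
    using that R inj unfolding d_def by (auto simp: inv_into_f_f)
  have dR: "d \<in> nat_vectors R" unfolding d_def by auto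
  have "\<forall>m\<in>{1..?g}. d (s m) < card (fresh C s ?g m)"
    using d s by fastforce
  then have "d \<in> coparking R C"
    unfolding iff[OF dR] by (intro exI[of _ s] conjI bij)
  moreover have "c i \<le> d i" if "i \<in> R" for i
  proof -
    have "i \<in> s ` {1..?g}" using that unfolding R .
    then obtain m where "m \<in> {1..?g}" "i = s m" by (rule imageE)
    then show ?thesis using d[of m] s[of m] by simp
  qed
  ultimately have "d = c" using max unfolding maximal_in_def by blast
  then have eq: "c (s m) + 1 = card (fresh C s ?g m)" if "m \<in> {1..?g}" for m
    using d[OF that] s[OF that] by simp
  have "vdegree R c + ?g = (\<Sum>m\<in>{1..?g}. c (s m)) + (\<Sum>m\<in>{1..?g}. 1)"
    unfolding vdegree_def using sum.reindex_bij_betw[OF bij, of c] by simp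
  also have "\<dots> = (\<Sum>m\<in>{1..?g}. card (fresh C s ?g m))"
    unfolding sum.distrib[symmetric] by (intro sum.cong refl eq)
  also have "\<dots> = card (cover C R)"
    using sum_card_fresh[of ?g C s] bij_betwE[OF bij] fin unfolding R by blast
  finally show ?thesis .
qed

text \<open>
  A point private to \<open>C i\<close>, here \<open>p i\<close>, makes every \<open>i\<close> block every set that contains it,
  as long as the vector vanishes at \<open>i\<close>.
\<close>

lemma zero_coparking:
  assumes "\<And>i. i \<in> R \<Longrightarrow> finite (C i)"
    and "\<And>i. i \<in> R \<Longrightarrow> p i \<in> C i"
    and "\<And>i j. i \<in> R \<Longrightarrow> j \<in> R \<Longrightarrow> i \<noteq> j \<Longrightarrow> p i \<notin> C j"
  shows "restrict (\<lambda>_. 0) R \<in> coparking R C"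
proof -
  have "\<not> can_fire C (restrict (\<lambda>_. 0) R) S" if S: "S \<subseteq> R" "S \<noteq> {}" for S
  proof -
    obtain i where i: "i \<in> S" "i \<in> R" using S by auto
    have "p i \<in> C i - cover C (S - {i})" using assms(2,3) i S(1) unfolding cover_def by blast
    then have "card (C i - cover C (S - {i})) > 0" using assms(1)[OF i(2)] by (auto simp: card_gt_0_iff)
    then show ?thesis
      unfolding can_fire_def using i by (auto simp: Int_once_covered intro!: bexI[of _ i])
  qed
  then show ?thesis unfolding coparking_def by auto
qed

section \<open>Fundamental circuits and rank\<close>

context matroid
begin

lemma finite_indep: "indep X \<Longrightarrow> finite X"
  using finite_subset[OF indep_subset finite_ground] .

lemma card_indep_le_basis:
  assumes "basis indep B" "indep I"
  shows "card I \<le> card B"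
proof (rule ccontr)
  assume "\<not> card I \<le> card B"
  then obtain x where "x \<in> I - B" "indep (insert x B)"
    using indep_augment[of B I] assms unfolding basis_def by auto
  then show False using assms(1) unfolding basis_def by blast
qed

lemma basis_if_card_ge:
  assumes B: "basis indep B" and I: "indep I" "card B \<le> card I"
  shows "basis indep I"
proof -
  have "J = I" if J: "indep J" "I \<subseteq> J" for J
    using card_seteq[OF finite_indep[OF J(1)] J(2)] card_indep_le_basis[OF B J(1)] I(2) by simp
  then show ?thesis using I(1) unfolding basis_def by blast
qed

lemma dependent_contains_circuit:
  assumes "X \<subseteq> E" "\<not> indep X"
  obtains D where "circuit E indep D" "D \<subseteq> X"
proof -
  let ?D = "{D. D \<subseteq> X \<and> \<not> indep D}"
  have "finite ?D" "?D \<noteq> {}"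
    using assms finite_subset[OF assms(1) finite_ground] by auto
  then obtain D where D: "D \<in> ?D" "\<forall>D'\<in>?D. D' \<subseteq> D \<longrightarrow> D = D'"
    using finite_has_minimal by (metis (no_types, lifting))
  then have "indep D'" if "D' \<subset> D" for D' using that by blast
  then have "circuit E indep D" using D(1) assms(1) unfolding circuit_def by blast
  then show thesis using that D(1) by blast
qed

lemma mrank_eqI:
  assumes "I \<subseteq> X" "indep I" and "\<And>J. J \<subseteq> X \<Longrightarrow> indep J \<Longrightarrow> card J \<le> card I"
  shows "mrank indep X = card I"
proof -
  have "{card J |J. J \<subseteq> X \<and> indep J} \<subseteq> {..card I}" using assms(3) by auto
  then have "finite {card J |J. J \<subseteq> X \<and> indep J}" by (rule finite_subset) simp
  then show ?thesis unfolding mrank_def using assms by (intro Max_eqI) auto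
qed

context
  fixes B
  assumes B: "basis indep B"
begin

lemma indep_basis: "indep B"
  using B by (simp add: basis_def)

abbreviation "FC \<equiv> fund_circuit E indep B"

lemma fund_circuit:
  assumes "i \<in> E - B"
  shows "circuit E indep (FC i)" "FC i \<subseteq> insert i B"
  using theI'[OF ex1_fund_circuit[OF B assms]] unfolding fund_circuit_def by auto

lemma fund_circuit_unique:
  assumes "i \<in> E - B" "circuit E indep D" "D \<subseteq> insert i B"
  shows "D = FC i"
  using ex1_fund_circuit[OF B assms(1)] fund_circuit[OF assms(1)] assms(2,3) by auto

lemma dependent_fund_circuit:
  assumes "i \<in> E - B" "FC i \<subseteq> X"
  shows "\<not> indep X"
  using fund_circuit(1)[OF assms(1)] indep_mono[OF _ assms(2)] unfolding circuit_def by blast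

lemma self_in_fund_circuit:
  assumes "i \<in> E - B"
  shows "i \<in> FC i"
  using dependent_fund_circuit[OF assms, of B] fund_circuit(2)[OF assms] indep_basis by blast

lemma finite_fund_circuit:
  assumes "i \<in> E - B"
  shows "finite (FC i)"
  using fund_circuit(1)[OF assms] finite_subset[OF _ finite_ground] unfolding circuit_def by blast

lemma cover_fund_circuits_decomp:
  "cover FC (E - B) = (E - B) \<union> (cover FC (E - B) \<inter> B)"
proof -
  have "E - B \<subseteq> cover FC (E - B)" using self_in_fund_circuit unfolding cover_def by blast
  moreover have "cover FC (E - B) \<subseteq> (E - B) \<union> B"
    using fund_circuit(2) unfolding cover_def by fast
  ultimately show ?thesis by blast
qed

lemma card_cover_fund_circuits:
  "card (cover FC (E - B)) = card (E - B) + card (cover FC (E - B) \<inter> B)"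
proof -
  have "finite B" by (rule finite_indep[OF indep_basis])
  then have "card ((E - B) \<union> (cover FC (E - B) \<inter> B)) = card (E - B) + card (cover FC (E - B) \<inter> B)"
    using finite_ground by (intro card_Un_disjoint) auto
  then show ?thesis by (metis cover_fund_circuits_decomp)
qed

text \<open>
  An independent subset of the cover larger than the part inside \<open>B\<close> would augment that part
  by some \<open>x \<notin> B\<close>, completing the fundamental circuit of \<open>x\<close>.
\<close>

lemma mrank_cover_fund_circuits:
  "mrank indep (cover FC (E - B)) = card (cover FC (E - B) \<inter> B)" (is "mrank indep ?A = _")
proof (rule mrank_eqI)
  show ind: "indep (?A \<inter> B)" by (rule indep_mono[OF indep_basis]) blast
  show "card J \<le> card (?A \<inter> B)" if J: "J \<subseteq> ?A" "indep J" for J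
  proof (rule ccontr)
    assume "\<not> ?thesis"
    then obtain x where x: "x \<in> J - ?A \<inter> B" "indep (insert x (?A \<inter> B))"
      using indep_augment[OF ind J(2)] by auto
    then have xR: "x \<in> E - B" using J indep_subset by blast
    then have "FC x \<subseteq> insert x (?A \<inter> B)" using fund_circuit(2)[OF xR] unfolding cover_def by blast
    then show False using dependent_fund_circuit[OF xR] x(2) by blast
  qed
qed auto

lemma mrank_ground: "mrank indep E = card B"
  using indep_subset[OF indep_basis] indep_basis card_indep_le_basis[OF B] by (rule mrank_eqI)

text \<open>
  For \<open>e\<close> in \<open>B\<close> and \<open>i\<close> outside, \<open>B - {e} \<union> {i}\<close> is a basis exactly if \<open>e\<close> lies in the
  circuit of \<open>i\<close>; and if some basis avoids \<open>e\<close>, augmenting \<open>B - {e}\<close> from it yields such an \<open>i\<close>.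
\<close>

lemma coloops_eq: "{e. coloop E indep e} = B - cover FC (E - B)"
proof (intro subset_antisym subsetI)
  fix e assume "e \<in> {e. coloop E indep e}"
  then have e: "\<And>B'. basis indep B' \<Longrightarrow> e \<in> B'" unfolding coloop_def by blast
  have eB: "e \<in> B" using e[OF B] .
  have "e \<notin> FC i" if i: "i \<in> E - B" for i
  proof
    assume eC: "e \<in> FC i"
    let ?B' = "insert i (B - {e})"
    have BE: "B \<subseteq> E" "finite B"
      using indep_subset[OF indep_basis] finite_indep[OF indep_basis] by simp_all
    have "indep ?B'"
    proof (rule ccontr)
      assume "\<not> indep ?B'"
      then obtain D where D: "circuit E indep D" "D \<subseteq> ?B'"
        using dependent_contains_circuit[of ?B'] BE i by blast
      then have "D = FC i" using fund_circuit_unique[OF i] by blast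
      then show False using D(2) eC eB i by blast
    qed
    moreover have "card ?B' = card B"
      using BE eB i card_Suc_Diff1[of B e] by simp
    ultimately have "basis indep ?B'" by (intro basis_if_card_ge[OF B]) simp_all
    then have "e \<in> ?B'" by (rule e)
    then show False using eB i by blast
  qed
  then show "e \<in> B - cover FC (E - B)" using eB unfolding cover_def by blast
next
  fix e assume e: "e \<in> B - cover FC (E - B)"
  have "e \<in> B'" if B': "basis indep B'" for B'
  proof (rule ccontr)
    assume eB': "e \<notin> B'"
    have "card (B - {e}) < card B" using e finite_indep[OF indep_basis] by (intro card_Diff1_less) auto
    also have "\<dots> \<le> card B'" using card_indep_le_basis[OF B' indep_basis] .
    finally obtain x where x: "x \<in> B' - (B - {e})" "indep (insert x (B - {e}))"
      using indep_augment[of "B - {e}" B'] B' indep_mono[OF indep_basis, of "B - {e}"]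
      by (auto simp: basis_def)
    have "B' \<subseteq> E" using B' indep_subset by (simp add: basis_def)
    then have xR: "x \<in> E - B" using x(1) eB' by blast
    then have "FC x \<subseteq> insert x (B - {e})"
      using fund_circuit(2)[OF xR] e unfolding cover_def by blast
    then show False using dependent_fund_circuit[OF xR] x(2) by blast
  qed
  then show "e \<in> {e. coloop E indep e}"
    using e indep_subset[OF indep_basis] unfolding coloop_def by blast
qed

lemma mrank_cover_plus_coloops:
  "mrank indep (cover FC (E - B)) + card {e. coloop E indep e} = mrank indep E"
proof -
  have "finite B" by (rule finite_indep[OF indep_basis])
  then have "card (B \<inter> cover FC (E - B)) + card (B - cover FC (E - B)) = card B"
    by (rule card_Int_Diff[symmetric])
  then show ?thesis
    by (simp add: mrank_cover_fund_circuits mrank_ground coloops_eq Int_commute)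
qed

end

end

section \<open>Coparking functions of fundamental circuits\<close>

theorem theorem4p19:
  fixes E B0 R :: "'a set" and indep :: "'a set \<Rightarrow> bool" and C :: "'a \<Rightarrow> 'a set" and g :: nat
  assumes "matroid E indep"
    and "basis indep B0"
    and "R = E - B0"
    and "g = card R"
    and "C = fund_circuit E indep B0"
  shows "coparking R C \<noteq> {} \<and> multicomplex R (coparking R C)
    \<and> (\<forall>c. maximal_in R (coparking R C) c \<longrightarrow>
          int (vdegree R c) = int (card (cover C R)) - int g)
    \<and> int (card (cover C R)) - int g = int (mrank indep (cover C R))
    \<and> int (mrank indep (cover C R)) = int (mrank indep E) - int (card {e. coloop E indep e})
    \<and> (\<forall>c\<in>nat_vectors R. c \<in> coparking R C \<longleftrightarrow>
          (\<exists>s. bij_betw s {1..g} R \<and>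
            (\<forall>m\<in>{1..g}. c (s m) < card (C (s m) - cover C (s ` {m+1..g})))))"
proof -
  interpret matroid E indep by (rule assms(1))
  note B = assms(2)
  have finR: "finite R" using finite_ground assms(3) by simp
  have fin: "\<And>i. i \<in> R \<Longrightarrow> finite (C i)"
    using finite_fund_circuit[OF B] assms(3,5) by simp
  have self: "\<And>i. i \<in> R \<Longrightarrow> i \<in> C i"
    using self_in_fund_circuit[OF B] assms(3,5) by simp
  have priv: "\<And>i j. i \<in> R \<Longrightarrow> j \<in> R \<Longrightarrow> i \<noteq> j \<Longrightarrow> i \<notin> C j"
    using fund_circuit(2)[OF B] assms(3,5) by blast
  have "coparking R C \<noteq> {}"
    using zero_coparking[of R C "\<lambda>i. i", OF fin self priv] by blast
  moreover have "multicomplex R (coparking R C)" by (rule multicomplex_coparking[OF finR])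
  moreover have "\<forall>c. maximal_in R (coparking R C) c \<longrightarrow>
      int (vdegree R c) = int (card (cover C R)) - int g"
    using vdegree_maximal_coparking[OF finR fin] unfolding assms(4) by fastforce
  moreover have "int (card (cover C R)) - int g = int (mrank indep (cover C R))"
    using card_cover_fund_circuits[OF B] mrank_cover_fund_circuits[OF B] assms(3-5) by simp
  moreover have "int (mrank indep (cover C R)) = int (mrank indep E) - int (card {e. coloop E indep e})"
    using mrank_cover_plus_coloops[OF B] unfolding assms(3,5) by linarith
  moreover have "\<forall>c\<in>nat_vectors R. c \<in> coparking R C \<longleftrightarrow>
      (\<exists>s. bij_betw s {1..g} R \<and> (\<forall>m\<in>{1..g}. c (s m) < card (fresh C s g m)))"
    unfolding assms(4) by (intro ballI coparking_iff_ordering[OF finR fin])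
  ultimately show ?thesis by (intro conjI)
qed

end
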